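(* Let $E_1$ and $E_2$ be finite sets of closed sentences such that every member of $E_1$ and every member of $E_2$ is certified adoptable, i.e. well-formed and $\omega$-true. Then the merged stock $E_1\cup E_2$ yields no contradiction: there is no term $c$ such that both $E_1\cup E_2\vdash c$ and $E_1\cup E_2\vdash\neg c$ are derivable in OGA.
   Context: **Syntax.** Terms: $t::=v_i\mid\bot\mid\mathbf 0\mid\mathbf S t\mid t=t\mid\neg t\mid t\lor t\mid\lambda t\mid t\cdot t\mid\mathcal R\mid\mathcal A$ ($v_i$, $i\in\mathbb N$, de Bruijn variables; $\lambda$ is the only binder; application associates to the left). A term is well-formed (wf) if generated by this grammar. $\bot$ is a divergent constant, $\mathcal R$ the primitive recursor, $\mathcal A$ the universal quantifier. Abbreviations: $t\,\mathsf N$ is $t=t$; $t\,\mathsf B$ is $t\lor\neg t$; $t\ne u$ is $\neg(t=u)$; $t\land u$ is $\neg(\neg t\lor\neg u)$; $t\to u$ is $\neg t\lor u$; $\underline n=\mathbf S^n\mathbf 0$. $\uparrow$ shifts all free indices up by one; $b[t]$ is the $\beta$-instance substituting $t$ for the outermost bound variable of $b$; $[v\mapsto s]$ is capture-avoiding substitution for a free variable; $\mathrm{fv}$ is the set of free variables. **Head steps** $\triangleright$: $(\lambda b)\cdot t\triangleright b[t]$; $\mathcal R\cdot g\cdot h\cdot\mathbf 0\triangleright g$; $\mathcal R\cdot g\cdot h\cdot(\mathbf S\underline n)\triangleright h\cdot\underline n\cdot(\mathcal R\cdot g\cdot h\cdot\underline n)$; if $t\triangleright t'$ then $t\cdot u\triangleright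 t'\cdot u$. **Rules.** Judgments are $\Gamma\vdash c$, $\Gamma$ a finite set of wf terms, $c$ a wf term (all terms in rules are wf). A proof is a finite list of judgments each following from earlier entries by one rule; $\Gamma\vdash c$ is derivable if it occurs in a proof. Rules ("$\Rightarrow$" from premises to conclusion, "$\Leftrightarrow$" both directions; $\Gamma$ is the context of a judgment when none is shown): $\Gamma,c\vdash c$; $\Gamma\vdash c\Rightarrow\Gamma,a\vdash c$; $\Gamma\vdash a$ and $\Gamma,a\vdash c\Rightarrow\Gamma\vdash c$; $\Gamma\vdash c\Rightarrow[v\mapsto s]\Gamma\vdash[v\mapsto s]c$; $\vdash a\Leftrightarrow\ \vdash a=\underline1$; $\vdash\neg a\Leftrightarrow\ \vdash a=\underline0$; $\vdash\neg a,\ \vdash a\Rightarrow\ \vdash c$; $\vdash a\Leftrightarrow\ \vdash\neg\neg a$; $\vdash a\Rightarrow\ \vdash a\lor b$; $\vdash b\Rightarrow\ \vdash a\lor b$; $\vdash\neg a,\ \vdash\neg b\Rightarrow\ \vdash\neg(a\lor b)$; $\vdash a\lor b,\ \Gamma,a\vdash c,\ \Gamma,b\vdash c\Rightarrow\ \vdash c$; $\vdash\neg(a\lor b)\Rightarrow\ \vdash\neg a$; $\vdash\neg(a\lor b)\Rightarrow\ \vdash\neg b$; $\vdash a\,\mathsf N\Leftrightarrow\ \vdash a=a$; $\vdash a=b\Rightarrow\ \vdash b=a$; $\vdash a=b,\ \vdash[v\mapsto a]p\Rightarrow\ \vdash[v\mapsto b]p$; $\vdash a\ne b\Rightarrow\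 \vdash b\ne a$; $\vdash a\,\mathsf N,\ \vdash b\,\mathsf N\Rightarrow\ \vdash(a=b)\,\mathsf B$; $\vdash(a=b)\,\mathsf B\Rightarrow\ \vdash(a\,\mathsf N)\land(b\,\mathsf N)$; $\vdash\mathbf 0\,\mathsf N$; $\vdash a\,\mathsf N\Leftrightarrow\ \vdash(\mathbf S a)\,\mathsf N$; $\vdash a\,\mathsf N\Rightarrow\ \vdash\mathbf S a\ne\mathbf 0$; $\vdash a\ne b\Leftrightarrow\ \vdash\mathbf S a\ne\mathbf S b$; $\vdash\mathbf S a=\mathbf S b\Rightarrow\ \vdash a=b$; $\vdash\bot\,\mathsf N\Rightarrow\ \vdash p$; induction: $\vdash[v_i\mapsto\mathbf 0]c$, $\ v_i\,\mathsf N,c,\Gamma\vdash[v_i\mapsto\mathbf S v_i]c$, $\ \vdash a\,\mathsf N\Rightarrow\ \vdash[v_i\mapsto a]c$ if $v_i\notin\mathrm{fv}(\Gamma)$; conversion, for $c\triangleright c'$: $\vdash c'\Rightarrow\ \vdash c$; $\vdash c\Rightarrow\ \vdash c'$; $\vdash\neg c\Rightarrow\ \vdash\neg c'$; $\vdash c'\,\mathsf N\Rightarrow\ \vdash c=c'$; $\vdash m\,\mathsf N,\ \vdash(h\cdot m\cdot(\mathcal R\cdot g\cdot h\cdot m))\,\mathsf N\Rightarrow\ \vdash\mathcal R\cdot g\cdot h\cdot(\mathbf S m)=h\cdot m\cdot(\mathcal R\cdot g\cdot h\cdot m)$; $v_0\,\mathsf N,\uparrow\Gamma\vdash\uparrow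 f\cdot v_0\Rightarrow\Gamma\vdash\mathcal A\cdot f$; $\vdash\mathcal A\cdot f,\ \vdash a\,\mathsf N\Rightarrow\ \vdash f\cdot a$; $\vdash\neg(f\cdot a),\ \vdash a\,\mathsf N\Rightarrow\ \vdash\neg(\mathcal A\cdot f)$; $\Gamma\vdash\neg(\mathcal A\cdot f)$ and $v_0\,\mathsf N,\neg(\uparrow f\cdot v_0),\uparrow\Gamma\vdash\uparrow c\Rightarrow\Gamma\vdash c$. These are the rules of RGA. OGA has these and the rule ATI: $\Gamma\vdash\mathcal A\cdot(\lambda((\uparrow u\cdot v_0)\,\mathsf B))\Rightarrow\Gamma\vdash(\mathcal A\cdot u)\,\mathsf B$. **$\omega$-truth.** Let $\Downarrow$ be the least relation between closed terms and naturals such that: $\mathbf 0\Downarrow0$; $t\Downarrow n$ implies $\mathbf S t\Downarrow n+1$; if $t\Downarrow m$, $u\Downarrow n$ then $(t=u)\Downarrow1$ when $m=n$ and $(t=u)\Downarrow0$ when $m\ne n$; $t\Downarrow1$ implies $\neg t\Downarrow0$, and $t\Downarrow0$ implies $\neg t\Downarrow1$; $t\lor u\Downarrow1$ if $t\Downarrow1$ or $u\Downarrow1$, and $t\lor u\Downarrow0$ if $t\Downarrow0$ and $u\Downarrow0$; for any finite list of arguments $\vec s$: $b[t]\cdot\vec s\Downarrow n$ implies $(\lambda b)\cdot t\cdot\vec s\Downarrow n$; if $a\Downarrow0$ and $g\cdot\vec s\Downarrow n$ then $\mathcal R\cdot g\cdot h\cdot a\cdot\vec s\Downarrow n$; if $a\Downarrow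 k+1$ and $h\cdot\underline k\cdot(\mathcal R\cdot g\cdot h\cdot\underline k)\cdot\vec s\Downarrow n$ then $\mathcal R\cdot g\cdot h\cdot a\cdot\vec s\Downarrow n$; $\mathcal A\cdot f\Downarrow1$ if $f\cdot\underline k\Downarrow1$ for all $k\in\mathbb N$; $\mathcal A\cdot f\Downarrow0$ if $f\cdot\underline k\Downarrow0$ for some $k$. A closed term $t$ is $\omega$-true if $t\Downarrow1$. *)

theory Defs
  imports Main
begin

text \<open>The elements of this datatype are exactly the well-formed terms, so well-formedness never
  appears as a separate side condition below.  Indices are de Bruijn indices, bound by \<open>Lam\<close> only.\<close>

datatype trm =
    Var nat
  | Bot
  | Zero
  | Succ trm
  | Eq trm trm  (infix "\<doteq>" 65)
  | Neg trm
  | Or trm trm  (infixr "\<squnion>" 60)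
  | Lam trm
  | App trm trm  (infixl "\<cdot>" 80)
  | Rec
  | Univ

abbreviation isN :: "trm \<Rightarrow> trm" where
  "isN t \<equiv> t \<doteq> t"

abbreviation isB :: "trm \<Rightarrow> trm" where
  "isB t \<equiv> t \<squnion> Neg t"

abbreviation Neq :: "trm \<Rightarrow> trm \<Rightarrow> trm" where
  "Neq t u \<equiv> Neg (t \<doteq> u)"

abbreviation Conj :: "trm \<Rightarrow> trm \<Rightarrow> trm" where
  "Conj t u \<equiv> Neg (Neg t \<squnion> Neg u)"

primrec numeral_trm :: "nat \<Rightarrow> trm" where
  "numeral_trm 0 = Zero"
| "numeral_trm (Suc n) = Succ (numeral_trm n)"

primrec fv :: "trm \<Rightarrow> nat set" where
  "fv (Var i) = {i}"
| "fv Bot = {}"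
| "fv Zero = {}"
| "fv (Succ t) = fv t"
| "fv (t \<doteq> u) = fv t \<union> fv u"
| "fv (Neg t) = fv t"
| "fv (t \<squnion> u) = fv t \<union> fv u"
| "fv (Lam b) = {i. Suc i \<in> fv b}"
| "fv (t \<cdot> u) = fv t \<union> fv u"
| "fv Rec = {}"
| "fv Univ = {}"

definition closed :: "trm \<Rightarrow> bool" where
  "closed t \<longleftrightarrow> fv t = {}"

text \<open>\<open>lift k\<close> increments the indices that are at least \<open>k\<close>.\<close>

primrec lift :: "nat \<Rightarrow> trm \<Rightarrow> trm" where
  "lift k (Var i) = Var (if i < k then i else Suc i)"
| "lift k Bot = Bot"
| "lift k Zero = Zero"
| "lift k (Succ t) = Succ (lift k t)"
| "lift k (t \<doteq> u) = (lift k t \<doteq> lift k u)"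
| "lift k (Neg t) = Neg (lift k t)"
| "lift k (t \<squnion> u) = (lift k t \<squnion> lift k u)"
| "lift k (Lam b) = Lam (lift (Suc k) b)"
| "lift k (t \<cdot> u) = lift k t \<cdot> lift k u"
| "lift k Rec = Rec"
| "lift k Univ = Univ"

abbreviation up :: "trm \<Rightarrow> trm" where
  "up \<equiv> lift 0"

text \<open>\<open>subst i s\<close> replaces the free variable with index \<open>i\<close> by \<open>s\<close> and leaves all other free
  variables unchanged.\<close>

primrec subst :: "nat \<Rightarrow> trm \<Rightarrow> trm \<Rightarrow> trm" where
  "subst i s (Var j) = (if j = i then s else Var j)"
| "subst i s Bot = Bot"
| "subst i s Zero = Zero"
| "subst i s (Succ t) = Succ (subst i s t)"
| "subst i s (t \<doteq> u) = (subst i s t \<doteq> subst i s u)"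
| "subst i s (Neg t) = Neg (subst i s t)"
| "subst i s (t \<squnion> u) = (subst i s t \<squnion> subst i s u)"
| "subst i s (Lam b) = Lam (subst (Suc i) (up s) b)"
| "subst i s (t \<cdot> u) = subst i s t \<cdot> subst i s u"
| "subst i s Rec = Rec"
| "subst i s Univ = Univ"

text \<open>In contrast to \<open>subst\<close>, \<open>inst k s\<close> removes a binder: it replaces index \<open>k\<close> by \<open>s\<close> and
  decrements the indices above \<open>k\<close>.\<close>

primrec inst :: "nat \<Rightarrow> trm \<Rightarrow> trm \<Rightarrow> trm" where
  "inst k s (Var j) = (if j < k then Var j else if j = k then s else Var (j - 1))"
| "inst k s Bot = Bot"
| "inst k s Zero = Zero"
| "inst k s (Succ t) = Succ (inst k s t)"
| "inst k s (t \<doteq> u) = (inst k s t \<doteq> inst k s u)"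
| "inst k s (Neg t) = Neg (inst k s t)"
| "inst k s (t \<squnion> u) = (inst k s t \<squnion> inst k s u)"
| "inst k s (Lam b) = Lam (inst (Suc k) (up s) b)"
| "inst k s (t \<cdot> u) = inst k s t \<cdot> inst k s u"
| "inst k s Rec = Rec"
| "inst k s Univ = Univ"

abbreviation beta_inst :: "trm \<Rightarrow> trm \<Rightarrow> trm" where
  "beta_inst b t \<equiv> inst 0 t b"

inductive head_step :: "trm \<Rightarrow> trm \<Rightarrow> bool"  (infix "\<rhd>" 50) where
  beta: "Lam b \<cdot> t \<rhd> beta_inst b t"
| rec_zero: "Rec \<cdot> g \<cdot> h \<cdot> Zero \<rhd> g"
| rec_succ: "Rec \<cdot> g \<cdot> h \<cdot> Succ (numeral_trm n)
    \<rhd> h \<cdot> numeral_trm n \<cdot> (Rec \<cdot> g \<cdot> h \<cdot> numeral_trm n)"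
| app: "t \<rhd> t' \<Longrightarrow> t \<cdot> u \<rhd> t' \<cdot> u"

type_synonym sequent = "trm set \<times> trm"

abbreviation seq :: "trm set \<Rightarrow> trm \<Rightarrow> sequent"  (infix "\<turnstile>" 45) where
  "\<Gamma> \<turnstile> c \<equiv> (\<Gamma>, c)"

text \<open>\<open>rga_rule Js J\<close> says that \<open>J\<close> follows from the premises \<open>Js\<close> by one application of a rule.
  Only the two premise-free rules need the condition that the context is finite: every other rule
  passes finiteness on from its premises to its conclusion.\<close>

inductive rga_rule :: "sequent list \<Rightarrow> sequent \<Rightarrow> bool" where
  hyp: "finite \<Gamma> \<Longrightarrow> rga_rule [] (insert c \<Gamma> \<turnstile> c)"
| weaken: "rga_rule [\<Gamma> \<turnstile> c] (insert a \<Gamma> \<turnstile> c)"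
| cut: "rga_rule [\<Gamma> \<turnstile> a, insert a \<Gamma> \<turnstile> c] (\<Gamma> \<turnstile> c)"
| substitution: "rga_rule [\<Gamma> \<turnstile> c] (subst i s ` \<Gamma> \<turnstile> subst i s c)"

| true_one: "rga_rule [\<Gamma> \<turnstile> a] (\<Gamma> \<turnstile> a \<doteq> numeral_trm 1)"
| one_true: "rga_rule [\<Gamma> \<turnstile> a \<doteq> numeral_trm 1] (\<Gamma> \<turnstile> a)"
| false_zero: "rga_rule [\<Gamma> \<turnstile> Neg a] (\<Gamma> \<turnstile> a \<doteq> numeral_trm 0)"
| zero_false: "rga_rule [\<Gamma> \<turnstile> a \<doteq> numeral_trm 0] (\<Gamma> \<turnstile> Neg a)"

| neg_elim: "rga_rule [\<Gamma> \<turnstile> Neg a, \<Gamma> \<turnstile> a] (\<Gamma> \<turnstile> c)"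
| neg_neg_intro: "rga_rule [\<Gamma> \<turnstile> a] (\<Gamma> \<turnstile> Neg (Neg a))"
| neg_neg_elim: "rga_rule [\<Gamma> \<turnstile> Neg (Neg a)] (\<Gamma> \<turnstile> a)"

| or_intro1: "rga_rule [\<Gamma> \<turnstile> a] (\<Gamma> \<turnstile> a \<squnion> b)"
| or_intro2: "rga_rule [\<Gamma> \<turnstile> b] (\<Gamma> \<turnstile> a \<squnion> b)"
| neg_or_intro: "rga_rule [\<Gamma> \<turnstile> Neg a, \<Gamma> \<turnstile> Neg b] (\<Gamma> \<turnstile> Neg (a \<squnion> b))"
| or_elim: "rga_rule [\<Gamma> \<turnstile> a \<squnion> b, insert a \<Gamma> \<turnstile> c, insert b \<Gamma> \<turnstile> c] (\<Gamma> \<turnstile> c)"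
| neg_or_elim1: "rga_rule [\<Gamma> \<turnstile> Neg (a \<squnion> b)] (\<Gamma> \<turnstile> Neg a)"
| neg_or_elim2: "rga_rule [\<Gamma> \<turnstile> Neg (a \<squnion> b)] (\<Gamma> \<turnstile> Neg b)"

| isN_eq: "rga_rule [\<Gamma> \<turnstile> isN a] (\<Gamma> \<turnstile> a \<doteq> a)"
| eq_isN: "rga_rule [\<Gamma> \<turnstile> a \<doteq> a] (\<Gamma> \<turnstile> isN a)"
| eq_sym: "rga_rule [\<Gamma> \<turnstile> a \<doteq> b] (\<Gamma> \<turnstile> b \<doteq> a)"
| eq_subst: "rga_rule [\<Gamma> \<turnstile> a \<doteq> b, \<Gamma> \<turnstile> subst i a p] (\<Gamma> \<turnstile> subst i b p)"
| neq_sym: "rga_rule [\<Gamma> \<turnstile> Neq a b] (\<Gamma> \<turnstile> Neq b a)"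
| eq_isB: "rga_rule [\<Gamma> \<turnstile> isN a, \<Gamma> \<turnstile> isN b] (\<Gamma> \<turnstile> isB (a \<doteq> b))"
| eq_isB_elim: "rga_rule [\<Gamma> \<turnstile> isB (a \<doteq> b)] (\<Gamma> \<turnstile> Conj (isN a) (isN b))"

| zero_isN: "finite \<Gamma> \<Longrightarrow> rga_rule [] (\<Gamma> \<turnstile> isN Zero)"
| succ_isN: "rga_rule [\<Gamma> \<turnstile> isN a] (\<Gamma> \<turnstile> isN (Succ a))"
| succ_isN_elim: "rga_rule [\<Gamma> \<turnstile> isN (Succ a)] (\<Gamma> \<turnstile> isN a)"
| succ_neq_zero: "rga_rule [\<Gamma> \<turnstile> isN a] (\<Gamma> \<turnstile> Neq (Succ a) Zero)"
| succ_neq: "rga_rule [\<Gamma> \<turnstile> Neq a b] (\<Gamma> \<turnstile> Neq (Succ a) (Succ b))"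
| succ_neq_elim: "rga_rule [\<Gamma> \<turnstile> Neq (Succ a) (Succ b)] (\<Gamma> \<turnstile> Neq a b)"
| succ_inj: "rga_rule [\<Gamma> \<turnstile> Succ a \<doteq> Succ b] (\<Gamma> \<turnstile> a \<doteq> b)"
| bot_elim: "rga_rule [\<Gamma> \<turnstile> isN Bot] (\<Gamma> \<turnstile> p)"

| induction: "i \<notin> (\<Union>d\<in>\<Gamma>. fv d) \<Longrightarrow>
    rga_rule [\<Gamma> \<turnstile> subst i Zero c,
              insert (isN (Var i)) (insert c \<Gamma>) \<turnstile> subst i (Succ (Var i)) c,
              \<Gamma> \<turnstile> isN a]
      (\<Gamma> \<turnstile> subst i a c)"

| conv_back: "c \<rhd> c' \<Longrightarrow> rga_rule [\<Gamma> \<turnstile> c'] (\<Gamma> \<turnstile> c)"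
| conv: "c \<rhd> c' \<Longrightarrow> rga_rule [\<Gamma> \<turnstile> c] (\<Gamma> \<turnstile> c')"
| conv_neg: "c \<rhd> c' \<Longrightarrow> rga_rule [\<Gamma> \<turnstile> Neg c] (\<Gamma> \<turnstile> Neg c')"
| conv_eq: "c \<rhd> c' \<Longrightarrow> rga_rule [\<Gamma> \<turnstile> isN c'] (\<Gamma> \<turnstile> c \<doteq> c')"

| rec_unfold: "rga_rule [\<Gamma> \<turnstile> isN m, \<Gamma> \<turnstile> isN (h \<cdot> m \<cdot> (Rec \<cdot> g \<cdot> h \<cdot> m))]
      (\<Gamma> \<turnstile> Rec \<cdot> g \<cdot> h \<cdot> Succ m \<doteq> h \<cdot> m \<cdot> (Rec \<cdot> g \<cdot> h \<cdot> m))"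

| univ_intro: "rga_rule [insert (isN (Var 0)) (up ` \<Gamma>) \<turnstile> up f \<cdot> Var 0] (\<Gamma> \<turnstile> Univ \<cdot> f)"
| univ_elim: "rga_rule [\<Gamma> \<turnstile> Univ \<cdot> f, \<Gamma> \<turnstile> isN a] (\<Gamma> \<turnstile> f \<cdot> a)"
| neg_univ_intro: "rga_rule [\<Gamma> \<turnstile> Neg (f \<cdot> a), \<Gamma> \<turnstile> isN a] (\<Gamma> \<turnstile> Neg (Univ \<cdot> f))"
| neg_univ_elim: "rga_rule [\<Gamma> \<turnstile> Neg (Univ \<cdot> f),
              insert (isN (Var 0)) (insert (Neg (up f \<cdot> Var 0)) (up ` \<Gamma>)) \<turnstile> up c]
      (\<Gamma> \<turnstile> c)"

inductive oga_rule :: "sequent list \<Rightarrow> sequent \<Rightarrow> bool" where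
  rga: "rga_rule Js J \<Longrightarrow> oga_rule Js J"
| ati: "oga_rule [\<Gamma> \<turnstile> Univ \<cdot> Lam (isB (up u \<cdot> Var 0))] (\<Gamma> \<turnstile> isB (Univ \<cdot> u))"

definition is_proof :: "(sequent list \<Rightarrow> sequent \<Rightarrow> bool) \<Rightarrow> sequent list \<Rightarrow> bool" where
  "is_proof R P \<longleftrightarrow>
     (\<forall>i < length P. \<exists>Js. set Js \<subseteq> set (take i P) \<and> R Js (P ! i))"

definition derivable :: "(sequent list \<Rightarrow> sequent \<Rightarrow> bool) \<Rightarrow> sequent \<Rightarrow> bool" where
  "derivable R J \<longleftrightarrow> (\<exists>P. is_proof R P \<and> J \<in> set P)"

abbreviation oga_derivable :: "sequent \<Rightarrow> bool" where
  "oga_derivable \<equiv> derivable oga_rule"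

abbreviation apps :: "trm \<Rightarrow> trm list \<Rightarrow> trm" where
  "apps \<equiv> foldl App"

text \<open>Evaluation relates closed terms to numbers.  The conclusion is required to be closed exactly in
  those rules where this is not already forced by the premises; see \<open>evals_closed\<close>.\<close>

inductive evals :: "trm \<Rightarrow> nat \<Rightarrow> bool"  (infix "\<Down>" 50) where
  zero: "Zero \<Down> 0"
| succ: "t \<Down> n \<Longrightarrow> Succ t \<Down> n + 1"
| eq_true: "t \<Down> m \<Longrightarrow> u \<Down> n \<Longrightarrow> m = n \<Longrightarrow> (t \<doteq> u) \<Down> 1"
| eq_false: "t \<Down> m \<Longrightarrow> u \<Down> n \<Longrightarrow> m \<noteq> n \<Longrightarrow> (t \<doteq> u) \<Down> 0"
| neg_true: "t \<Down> 1 \<Longrightarrow> Neg t \<Down> 0"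
| neg_false: "t \<Down> 0 \<Longrightarrow> Neg t \<Down> 1"
| or_true1: "closed (t \<squnion> u) \<Longrightarrow> t \<Down> 1 \<Longrightarrow> (t \<squnion> u) \<Down> 1"
| or_true2: "closed (t \<squnion> u) \<Longrightarrow> u \<Down> 1 \<Longrightarrow> (t \<squnion> u) \<Down> 1"
| or_false: "t \<Down> 0 \<Longrightarrow> u \<Down> 0 \<Longrightarrow> (t \<squnion> u) \<Down> 0"
| beta: "closed (apps (Lam b \<cdot> t) ss) \<Longrightarrow> apps (beta_inst b t) ss \<Down> n
    \<Longrightarrow> apps (Lam b \<cdot> t) ss \<Down> n"
| rec_zero: "closed (apps (Rec \<cdot> g \<cdot> h \<cdot> a) ss) \<Longrightarrow> a \<Down> 0 \<Longrightarrow> apps g ss \<Down> n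
    \<Longrightarrow> apps (Rec \<cdot> g \<cdot> h \<cdot> a) ss \<Down> n"
| rec_succ: "a \<Down> k + 1
    \<Longrightarrow> apps (h \<cdot> numeral_trm k \<cdot> (Rec \<cdot> g \<cdot> h \<cdot> numeral_trm k)) ss \<Down> n
    \<Longrightarrow> apps (Rec \<cdot> g \<cdot> h \<cdot> a) ss \<Down> n"
| univ_true: "(\<And>k. f \<cdot> numeral_trm k \<Down> 1) \<Longrightarrow> Univ \<cdot> f \<Down> 1"
| univ_false: "f \<cdot> numeral_trm k \<Down> 0 \<Longrightarrow> Univ \<cdot> f \<Down> 0"

lemma fv_apps: "fv (apps t ss) = fv t \<union> (\<Union>s\<in>set ss. fv s)"
  by (induction ss arbitrary: t) auto

lemma evals_closed: "t \<Down> n \<Longrightarrow> closed t"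
  by (induction rule: evals.induct) (auto simp: closed_def fv_apps)

definition omega_true :: "trm \<Rightarrow> bool" where
  "omega_true t \<longleftrightarrow> closed t \<and> t \<Down> 1"

text \<open>Adoptable means well-formed and \<open>\<omega>\<close>-true; every \<open>trm\<close> is well-formed.\<close>

definition certified_adoptable :: "trm \<Rightarrow> bool" where
  "certified_adoptable t \<longleftrightarrow> omega_true t"

end

theory Submission imports Defs begin

text \<open>The calculus is sound for \<open>\<omega>\<close>-truth: if a substitution of closed (possibly divergent) terms makes
  every member of \<open>\<Gamma>\<close> evaluate to 1, then it makes \<open>c\<close> evaluate to 1 whenever \<open>\<Gamma> \<turnstile> c\<close> is
  derivable.  The rules that replace equals by equals, and those that pass between numerals and terms
  with a numerical value, need that closed terms of equal value are interchangeable in every context.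
  This is shown for the least compatible relation relating such terms; its one delicate point is
  that a term with a value diverges as soon as it is applied to an argument, so that a replaced
  subterm is never the proper prefix of an evaluated application.  Since evaluation is
  deterministic, no context made true by some substitution proves both \<open>c\<close> and \<open>Neg c\<close>.\<close>

section \<open>Parallel substitution\<close>

text \<open>The environment for the body of a binder: the bound index stays fixed and the images of
  the outer variables are shifted past it.\<close>

definition exts :: "(nat \<Rightarrow> trm) \<Rightarrow> nat \<Rightarrow> trm" where
  "exts \<sigma> = case_nat (Var 0) (\<lambda>i. up (\<sigma> i))"

lemma exts_simps [simp]: "exts \<sigma> 0 = Var 0" "exts \<sigma> (Suc i) = up (\<sigma> i)"
  by (simp_all add: exts_def)

text \<open>Simultaneous substitution has \<open>lift\<close>, \<open>subst\<close> and
  \<open>inst\<close> as instances, so the single composition law \<open>psubst_psubst\<close>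
  replaces a family of pairwise commutation laws. It also serves as the interpretation of open terms
  in the soundness proof.\<close>

primrec psubst :: "(nat \<Rightarrow> trm) \<Rightarrow> trm \<Rightarrow> trm" where
  "psubst \<sigma> (Var i) = \<sigma> i"
| "psubst \<sigma> Bot = Bot"
| "psubst \<sigma> Zero = Zero"
| "psubst \<sigma> (Succ t) = Succ (psubst \<sigma> t)"
| "psubst \<sigma> (t \<doteq> u) = (psubst \<sigma> t \<doteq> psubst \<sigma> u)"
| "psubst \<sigma> (Neg t) = Neg (psubst \<sigma> t)"
| "psubst \<sigma> (t \<squnion> u) = (psubst \<sigma> t \<squnion> psubst \<sigma> u)"
| "psubst \<sigma> (Lam b) = Lam (psubst (exts \<sigma>) b)"
| "psubst \<sigma> (t \<cdot> u) = psubst \<sigma> t \<cdot> psubst \<sigma> u"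
| "psubst \<sigma> Rec = Rec"
| "psubst \<sigma> Univ = Univ"

lemma psubst_cong: "(\<And>i. i \<in> fv t \<Longrightarrow> \<sigma> i = \<tau> i) \<Longrightarrow> psubst \<sigma> t = psubst \<tau> t"
proof (induction t arbitrary: \<sigma> \<tau>)
  case (Eq t u)
  then show ?case by (metis UnI1 UnI2 fv.simps(5) psubst.simps(5))
next
  case (Or t u)
  then show ?case by (metis UnI1 UnI2 fv.simps(7) psubst.simps(7))
next
  case (App t u)
  then show ?case by (metis UnI1 UnI2 fv.simps(9) psubst.simps(9))
next
  case (Lam b)
  have "exts \<sigma> i = exts \<tau> i" if "i \<in> fv b" for i
    using that Lam.prems by (cases i) auto
  then have "psubst (exts \<sigma>) b = psubst (exts \<tau>) b" by (rule Lam.IH)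
  then show ?case by simp
next
  case (Succ t)
  have "psubst \<sigma> t = psubst \<tau> t" by (rule Succ.IH) (simp add: Succ.prems)
  then show ?case by simp
next
  case (Neg t)
  have "psubst \<sigma> t = psubst \<tau> t" by (rule Neg.IH) (simp add: Neg.prems)
  then show ?case by simp
qed simp_all

lemma exts_Var: "exts Var = Var"
  by (rule ext) (simp add: exts_def split: nat.split)

lemma psubst_Var: "psubst Var t = t"
  by (induction t) (simp_all add: exts_Var)

lemma psubst_closed: "closed t \<Longrightarrow> psubst \<sigma> t = t"
  using psubst_cong[of t \<sigma> Var] by (simp add: closed_def psubst_Var)

lemma lift_lift: "j \<le> k \<Longrightarrow> lift (Suc k) (lift j t) = lift j (lift k t)"
  by (induction t arbitrary: j k) auto

lemma psubst_lift: "psubst \<sigma> (lift k t) = psubst (\<lambda>i. \<sigma> (if i < k then i else Suc i)) t"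
proof (induction t arbitrary: \<sigma> k)
  case (Lam b)
  have "(\<lambda>i. exts \<sigma> (if i < Suc k then i else Suc i)) = exts (\<lambda>i. \<sigma> (if i < k then i else Suc i))"
    by (rule ext) (simp add: exts_def split: nat.split)
  then show ?case using Lam.IH by simp
qed simp_all

lemma psubst_up: "psubst \<sigma> (up t) = psubst (\<lambda>i. \<sigma> (Suc i)) t"
  by (simp add: psubst_lift)

lemma lift_psubst: "lift k (psubst \<sigma> t) = psubst (\<lambda>i. lift k (\<sigma> i)) t"
proof (induction t arbitrary: \<sigma> k)
  case (Lam b)
  have "(\<lambda>i. lift (Suc k) (exts \<sigma> i)) = exts (\<lambda>i. lift k (\<sigma> i))"
    by (rule ext) (simp add: exts_def lift_lift split: nat.split)
  then show ?case using Lam.IH by simp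
qed simp_all

text \<open>Under a binder the claim becomes that \<open>exts\<close> respects composition, where an
  outer variable meets a shift on each side; \<open>psubst_up\<close> and \<open>lift_psubst\<close>
  move these shifts into the environments.\<close>

lemma psubst_psubst: "psubst \<sigma> (psubst \<tau> t) = psubst (\<lambda>i. psubst \<sigma> (\<tau> i)) t"
proof (induction t arbitrary: \<sigma> \<tau>)
  case (Lam b)
  have "(\<lambda>i. psubst (exts \<sigma>) (exts \<tau> i)) = exts (\<lambda>i. psubst \<sigma> (\<tau> i))"
    by (rule ext) (simp add: exts_def psubst_up lift_psubst split: nat.split)
  then show ?case using Lam.IH by simp
qed simp_all

lemma lift_eq_psubst: "lift k t = psubst (\<lambda>i. Var (if i < k then i else Suc i)) t"
  using psubst_lift[of Var k t] by (simp add: psubst_Var)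

lemma lift_closed: "closed t \<Longrightarrow> lift k t = t"
  by (simp add: lift_eq_psubst psubst_closed)

lemma subst_eq_psubst: "subst i s t = psubst (Var(i := s)) t"
proof (induction t arbitrary: i s)
  case (Lam b)
  have "Var(Suc i := up s) = exts (Var(i := s))"
    by (rule ext) (simp add: exts_def split: nat.split)
  then show ?case by (simp only: subst.simps psubst.simps Lam.IH)
qed simp_all

definition inst_env :: "nat \<Rightarrow> trm \<Rightarrow> nat \<Rightarrow> trm" where
  "inst_env k s j = (if j < k then Var j else if j = k then s else Var (j - 1))"

lemma inst_eq_psubst: "inst k s t = psubst (inst_env k s) t"
proof (induction t arbitrary: k s)
  case (Lam b)
  have "inst_env (Suc k) (up s) = exts (inst_env k s)"
    by (rule ext) (auto simp: exts_def inst_env_def split: nat.split)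
  then show ?case using Lam.IH by simp
qed (simp_all add: inst_env_def)

text \<open>Turns the substitutions occurring in the rules into an update of the interpreting
  environment.\<close>

lemma psubst_subst: "psubst \<sigma> (subst i s t) = psubst (\<sigma>(i := psubst \<sigma> s)) t"
  by (auto simp: subst_eq_psubst psubst_psubst intro: psubst_cong)

lemma psubst_beta_inst: "psubst \<sigma> (beta_inst b t) = beta_inst (psubst (exts \<sigma>) b) (psubst \<sigma> t)"
proof -
  have "psubst \<sigma> (inst_env 0 t i) = psubst (inst_env 0 (psubst \<sigma> t)) (exts \<sigma> i)" for i
  proof (cases i)
    case (Suc j)
    \<comment> \<open>Above the instantiated index, \<open>inst_env\<close> merely undoes the shift
      introduced by \<open>exts\<close>.\<close>
    have "(\<lambda>i. inst_env 0 (psubst \<sigma> t) (Suc i)) = Var"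
      by (rule ext) (simp add: inst_env_def)
    then show ?thesis using Suc by (simp add: psubst_up psubst_Var) (simp add: inst_env_def)
  qed (simp add: inst_env_def)
  then show ?thesis by (simp add: inst_eq_psubst psubst_psubst)
qed

lemma beta_inst_up: "beta_inst (up t) s = t"
  by (simp add: inst_eq_psubst psubst_up inst_env_def psubst_Var)

section \<open>Free variables and closedness under substitution\<close>

lemma fv_lift: "fv (lift k t) \<subseteq> (\<lambda>i. if i < k then i else Suc i) ` fv t"
proof (induction t arbitrary: k)
  case (Lam b)
  show ?case
  proof
    fix i assume "i \<in> fv (lift k (Lam b))"
    then obtain j where "j \<in> fv b" "Suc i = (if j < Suc k then j else Suc j)"
      using Lam.IH[of "Suc k"] by fastforce
    then show "i \<in> (\<lambda>i. if i < k then i else Suc i) ` fv (Lam b)"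
      \<comment> \<open>In either branch \<open>j\<close> is positive, so \<open>j - 1\<close> is
        the same variable seen from outside the binder.\<close>
      by (intro image_eqI[of _ _ "j - 1"]) (auto split: if_splits)
  qed
qed (simp_all only: fv.simps lift.simps image_Un Un_mono, simp_all)

lemma fv_psubst: "fv (psubst \<sigma> t) \<subseteq> (\<Union>i\<in>fv t. fv (\<sigma> i))"
proof (induction t arbitrary: \<sigma>)
  case (Lam b)
  show ?case
  proof
    fix i assume "i \<in> fv (psubst \<sigma> (Lam b))"
    then obtain j where j: "j \<in> fv b" "Suc i \<in> fv (exts \<sigma> j)"
      using Lam.IH[of "exts \<sigma>"] by auto
    have "\<exists>l. j = Suc l \<and> i \<in> fv (\<sigma> l)"
      using j(2) fv_lift[of 0] by (cases j) auto
    then show "i \<in> (\<Union>i\<in>fv (Lam b). fv (\<sigma> i))"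
      using j(1) by auto
  qed
qed (simp_all add: le_supI1 le_supI2)

lemma closed_psubst: "(\<And>i. closed (\<sigma> i)) \<Longrightarrow> closed (psubst \<sigma> t)"
  using fv_psubst[of \<sigma> t] by (auto simp: closed_def)

lemma closed_numeral: "closed (numeral_trm n)"
  by (induction n) (auto simp: closed_def)

lemma closed_inst: "closed (Lam b) \<Longrightarrow> closed t \<Longrightarrow> closed (beta_inst b t)"
proof -
  assume "closed (Lam b)" "closed t"
  then have "fv (inst_env 0 t i) = {}" if "i \<in> fv b" for i
    using that by (cases i) (auto simp: inst_env_def closed_def)
  then show ?thesis
    using fv_psubst[of "inst_env 0 t" b] by (auto simp: closed_def inst_eq_psubst)
qed

section \<open>Evaluation\<close>

text \<open>Several evaluation rules conclude about \<open>apps t ss\<close>, which is not a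
  constructor pattern. Comparing heads and argument lists decides which rules can match a given
  term.\<close>

fun head :: "trm \<Rightarrow> trm" where
  "head (t \<cdot> u) = head t"
| "head t = t"

fun args :: "trm \<Rightarrow> trm list" where
  "args (t \<cdot> u) = args t @ [u]"
| "args t = []"

lemma head_apps [simp]: "head (apps t ss) = head t"
  by (induction ss arbitrary: t) auto

lemma args_apps [simp]: "args (apps t ss) = args t @ ss"
  by (induction ss arbitrary: t) auto

lemma apps_eqD: "apps t ss = u \<Longrightarrow> head t = head u \<and> args t @ ss = args u"
  by auto

lemma eq_appsD: "u = apps t ss \<Longrightarrow> head u = head t \<and> args u = args t @ ss"
  by auto

lemma evals_numeral: "numeral_trm n \<Down> n"
  by (induction n) (auto intro: evals.zero dest: evals.succ)

section \<open>Inversion of evaluation\<close>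

lemma evals_ZeroD: "Zero \<Down> n \<Longrightarrow> n = 0"
  by (erule evals.cases) (auto dest!: eq_appsD)

lemma evals_SuccD: "Succ t \<Down> n \<Longrightarrow> \<exists>m. n = Suc m \<and> t \<Down> m"
  by (erule evals.cases) (auto dest!: eq_appsD)

lemma evals_EqD: "(t \<doteq> u) \<Down> n \<Longrightarrow> \<exists>m k. t \<Down> m \<and> u \<Down> k \<and> n = (if m = k then 1 else 0)"
  by (erule evals.cases) (auto dest!: eq_appsD)

lemma evals_NegD: "Neg t \<Down> n \<Longrightarrow> n = 0 \<and> t \<Down> 1 \<or> n = 1 \<and> t \<Down> 0"
  by (erule evals.cases) (auto dest!: eq_appsD)

lemma evals_OrD: "(t \<squnion> u) \<Down> n \<Longrightarrow> n = 1 \<and> (t \<Down> 1 \<or> u \<Down> 1) \<or> n = 0 \<and> t \<Down> 0 \<and> u \<Down> 0"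
  by (erule evals.cases) (auto dest!: eq_appsD)

lemma evals_UnivD:
  "Univ \<cdot> f \<Down> n \<Longrightarrow> n = 1 \<and> (\<forall>k. f \<cdot> numeral_trm k \<Down> 1) \<or> n = 0 \<and> (\<exists>k. f \<cdot> numeral_trm k \<Down> 0)"
  by (erule evals.cases) (auto dest!: eq_appsD)

lemma evals_betaD: "apps (Lam b \<cdot> t) ss \<Down> n \<Longrightarrow> apps (beta_inst b t) ss \<Down> n"
  by (erule evals.cases) (auto dest!: apps_eqD)

lemma evals_RecD: "apps (Rec \<cdot> g \<cdot> h \<cdot> a) ss \<Down> n \<Longrightarrow> a \<Down> 0 \<and> apps g ss \<Down> n \<or>
   (\<exists>k. a \<Down> Suc k \<and> apps (h \<cdot> numeral_trm k \<cdot> (Rec \<cdot> g \<cdot> h \<cdot> numeral_trm k)) ss \<Down> n)"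
  by (erule evals.cases) (auto dest!: apps_eqD)

lemma evals_head:
  "t \<Down> n \<Longrightarrow> args t \<noteq> [] \<Longrightarrow> (\<exists>b. head t = Lam b) \<or> head t = Rec \<or> (\<exists>f. t = Univ \<cdot> f)"
  by (cases rule: evals.cases) auto

text \<open>Restricts the proper prefixes of an evaluated application; a term of any other shape
  blocks evaluation once it is given an argument.\<close>

lemma evals_appsD:
  assumes "apps t ss \<Down> n" "ss \<noteq> []"
  shows "(\<exists>b. head t = Lam b) \<or> head t = Rec \<or> t = Univ"
proof -
  consider "\<exists>b. head t = Lam b" | "head t = Rec" | f where "apps t ss = Univ \<cdot> f"
    using evals_head[OF assms(1)] assms(2) by auto
  then show ?thesis
  proof cases
    case (3 f)
    \<comment> \<open>The quantifier evaluates with exactly one argument, so removing that argument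
      leaves the constant itself and no room for others.\<close>
    then have "apps t (butlast ss) = Univ" using assms(2) by (cases ss rule: rev_cases) auto
    then show ?thesis by (cases "butlast ss" rule: rev_cases) auto
  qed auto
qed

lemma not_evals_Lam: "\<not> Lam b \<Down> n"
  by (auto elim: evals.cases dest!: eq_appsD)

lemma not_evals_Rec: "\<not> Rec \<Down> n"
  by (auto elim: evals.cases dest!: eq_appsD)

lemma not_evals_Univ: "\<not> Univ \<Down> n"
  by (auto elim: evals.cases dest!: eq_appsD)

lemma not_evals_Bot: "\<not> Bot \<Down> n"
  by (auto elim: evals.cases dest!: eq_appsD)

text \<open>Induction on one evaluation with inversion of the other. The two rules for a true
  disjunction agree on the value 1, and a true and a false outcome of a disjunction or quantifier
  would clash at a single disjunct or numeral instance, where the induction hypothesis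
  applies.\<close>

lemma evals_deterministic: "t \<Down> m \<Longrightarrow> t \<Down> n \<Longrightarrow> m = n"
proof (induction arbitrary: n rule: evals.induct)
  case zero
  then show ?case by (simp add: evals_ZeroD)
next
  case (succ t m)
  from evals_SuccD[OF succ.prems] obtain k where "n = Suc k" "t \<Down> k" by blast
  then show ?case using succ.IH[of k] by simp
next
  case (eq_true t m u k)
  from evals_EqD[OF eq_true.prems] obtain i j
    where "t \<Down> i" "u \<Down> j" "n = (if i = j then 1 else 0)" by blast
  then show ?case using eq_true.IH(1)[of i] eq_true.IH(2)[of j] eq_true.hyps by simp
next
  case (eq_false t m u k)
  from evals_EqD[OF eq_false.prems] obtain i j
    where "t \<Down> i" "u \<Down> j" "n = (if i = j then 1 else 0)" by blast
  then show ?case using eq_false.IH(1)[of i] eq_false.IH(2)[of j] eq_false.hyps by simp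
next
  case (neg_true t)
  show ?case using evals_NegD[OF neg_true.prems] neg_true.IH[of 0] by auto
next
  case (neg_false t)
  show ?case using evals_NegD[OF neg_false.prems] neg_false.IH[of 1] by auto
next
  case (or_true1 t u)
  show ?case using evals_OrD[OF or_true1.prems] or_true1.IH[of 0] by auto
next
  case (or_true2 t u)
  show ?case using evals_OrD[OF or_true2.prems] or_true2.IH[of 0] by auto
next
  case (or_false t u)
  have "\<not> t \<Down> 1" "\<not> u \<Down> 1" using or_false.IH zero_neq_one by blast+
  then show ?case using evals_OrD[OF or_false.prems] by blast
next
  case (beta b t ss m)
  from beta.prems have "apps (beta_inst b t) ss \<Down> n" by (rule evals_betaD)
  then show ?case by (rule beta.IH)
next
  case (rec_zero g h a ss m)
  have "\<not> a \<Down> Suc k" for k using rec_zero.IH(1)[of "Suc k"] by auto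
  then show ?case using evals_RecD[of g h a ss n] rec_zero.prems rec_zero.IH(2)[of n] by auto
next
  case (rec_succ a k h g ss m)
  have "j = Suc k" if "a \<Down> j" for j using rec_succ.IH(1)[OF that] by simp
  then show ?case using evals_RecD[of g h a ss n] rec_succ.prems rec_succ.IH(2)[of n] by blast
next
  case (univ_true f)
  have "\<not> f \<cdot> numeral_trm k \<Down> 0" for k using univ_true.IH[of k 0] by auto
  then show ?case using evals_UnivD[OF univ_true.prems] by auto
next
  case (univ_false f k)
  have "\<not> f \<cdot> numeral_trm k \<Down> 1" using univ_false.IH[of 1] by auto
  then show ?case using evals_UnivD[OF univ_false.prems] by auto
qed

text \<open>A \<beta>-step or recursor step is unaffected by further arguments, so the induction
  hypothesis for the reduct applies to the longer list; determinism makes the recursor take the same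
  branch. All other rules produce terms excluded as prefixes by \<open>evals_appsD\<close>.\<close>

lemma evals_not_applicable: "t \<Down> m \<Longrightarrow> ss \<noteq> [] \<Longrightarrow> \<not> apps t ss \<Down> n"
proof (induction arbitrary: n ss rule: evals.induct)
  case (beta b t rs m)
  then show ?case using evals_betaD[of b t "rs @ ss" n] by auto
next
  case (rec_zero g h a rs m)
  have "\<not> a \<Down> Suc k" for k using evals_deterministic[OF rec_zero.hyps(2), of "Suc k"] by auto
  then show ?case
    using evals_RecD[of g h a "rs @ ss" n] rec_zero.IH(2)[OF rec_zero.prems, of n] by auto
next
  case (rec_succ a k h g rs m)
  have "j = Suc k" if "a \<Down> j" for j using evals_deterministic[OF rec_succ.hyps(1) that] by simp
  then show ?case
    using evals_RecD[of g h a "rs @ ss" n] rec_succ.IH(2)[OF rec_succ.prems, of n] by fastforce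
qed (auto dest: evals_appsD)

text \<open>The trailing arguments are needed for the induction, since \<open>app\<close> steps
  inside the function position. Closedness is demanded of the redex because a step may discard an
  argument, about which the value of the reduct then says nothing.\<close>

lemma head_step_apps: "c \<rhd> c' \<Longrightarrow> closed (apps c ss) \<Longrightarrow> apps c ss \<Down> n \<longleftrightarrow> apps c' ss \<Down> n"
proof (induction arbitrary: ss rule: head_step.induct)
  case (beta b t)
  show ?case using evals.beta[OF beta.prems] evals_betaD[of b t ss n] by blast
next
  case (rec_zero g h)
  have "\<not> Zero \<Down> Suc k" for k using evals_ZeroD[of "Suc k"] by auto
  then show ?case
    using evals.rec_zero[OF rec_zero.prems evals.zero] evals_RecD[of g h Zero ss n] by blast
next
  case (rec_succ g h k)
  have val: "Succ (numeral_trm k) \<Down> k + 1" by (rule evals.succ[OF evals_numeral])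
  then have "j = Suc k" if "Succ (numeral_trm k) \<Down> j" for j
    using evals_deterministic[OF that val] by simp
  then show ?case
    using evals.rec_succ[OF val, of h g ss n] evals_RecD[of g h "Succ (numeral_trm k)" ss n] by blast
next
  case (app t t' u)
  then show ?case using app.IH[of "u # ss"] by simp
qed

lemma evals_head_step: "c \<rhd> c' \<Longrightarrow> closed c \<Longrightarrow> c \<Down> n \<longleftrightarrow> c' \<Down> n"
  using head_step_apps[of c c' "[]"] by simp

lemma psubst_numeral [simp]: "psubst \<sigma> (numeral_trm n) = numeral_trm n"
  by (simp add: psubst_closed closed_numeral)

lemma head_step_psubst: "c \<rhd> c' \<Longrightarrow> psubst \<sigma> c \<rhd> psubst \<sigma> c'"
  by (induction rule: head_step.induct) (auto simp: psubst_beta_inst intro: head_step.intros)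

section \<open>Interchangeability of terms of equal value\<close>

text \<open>Defined on open terms so that it can pass under \<open>Lam\<close>. Its only
  non-structural rule \<open>base\<close> relates closed terms, which lifting and substitution leave
  fixed.\<close>

inductive coval :: "trm \<Rightarrow> trm \<Rightarrow> bool" where
  base: "a \<Down> m \<Longrightarrow> b \<Down> m \<Longrightarrow> coval a b"
| Var: "coval (Var i) (Var i)"
| Bot: "coval Bot Bot"
| Zero: "coval Zero Zero"
| Succ: "coval t t' \<Longrightarrow> coval (Succ t) (Succ t')"
| Eq: "coval t t' \<Longrightarrow> coval u u' \<Longrightarrow> coval (t \<doteq> u) (t' \<doteq> u')"
| Neg: "coval t t' \<Longrightarrow> coval (Neg t) (Neg t')"
| Or: "coval t t' \<Longrightarrow> coval u u' \<Longrightarrow> coval (t \<squnion> u) (t' \<squnion> u')"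
| Lam: "coval b b' \<Longrightarrow> coval (Lam b) (Lam b')"
| App: "coval t t' \<Longrightarrow> coval u u' \<Longrightarrow> coval (t \<cdot> u) (t' \<cdot> u')"
| Rec: "coval Rec Rec"
| Univ: "coval Univ Univ"

lemma coval_refl: "coval t t"
  by (induction t) (auto intro: coval.intros)

lemma coval_lift: "coval t t' \<Longrightarrow> coval (lift k t) (lift k t')"
proof (induction arbitrary: k rule: coval.induct)
  case (base a m b)
  then show ?case using lift_closed evals_closed coval.base by metis
qed (auto intro: coval.intros)

text \<open>Both the term and the environment vary, because in a \<beta>-redex the body and the
  argument may each contain replaced subterms.\<close>

lemma coval_psubst:
  "coval t t' \<Longrightarrow> (\<And>i. coval (\<sigma> i) (\<sigma>' i)) \<Longrightarrow> coval (psubst \<sigma> t) (psubst \<sigma>' t')"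
proof (induction arbitrary: \<sigma> \<sigma>' rule: coval.induct)
  case (base a m b)
  then show ?case using psubst_closed evals_closed coval.base by metis
next
  case (Lam b b')
  have "coval (exts \<sigma> i) (exts \<sigma>' i)" for i
    using Lam.prems by (cases i) (auto intro: coval.Var coval_lift)
  then show ?case using Lam.IH by (auto intro: coval.Lam)
qed (auto intro: coval.intros)

lemma coval_beta_inst: "coval b b' \<Longrightarrow> coval t t' \<Longrightarrow> coval (beta_inst b t) (beta_inst b' t')"
  unfolding inst_eq_psubst
  by (erule coval_psubst) (auto simp: inst_env_def intro: coval.Var)

lemma coval_apps: "list_all2 coval ss ss' \<Longrightarrow> coval t t' \<Longrightarrow> coval (apps t ss) (apps t' ss')"
  by (induction arbitrary: t t' rule: list_all2_induct) (auto intro: coval.App)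

text \<open>Inside an evaluated application, \<open>base\<close> can relate only the whole term, the
  head or individual arguments. The surplus arguments \<open>rs\<close> record how far the prefix
  under inspection is from the whole.\<close>

lemma coval_apps_cases:
  assumes "coval (apps t ss) t'" and "apps t (ss @ rs) \<Down> n"
  shows "rs = [] \<and> t' \<Down> n \<or> (\<exists>u ss'. t' = apps u ss' \<and> coval t u \<and> list_all2 coval ss ss')"
  using assms
proof (induction ss arbitrary: t' rs rule: rev_induct)
  case Nil
  then show ?case by (intro disjI2 exI[of _ t'] exI[of _ "[]"]) simp
next
  case (snoc s ss)
  from snoc.prems(1) have "coval (apps t ss \<cdot> s) t'" by simp
  then show ?case
  proof cases
    case (base m)
    \<comment> \<open>A prefix with a value admits no further argument, so \<open>rs\<close> is
      empty and determinism gives \<open>t'\<close> the value \<open>n\<close>.\<close>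
    then show ?thesis
      using snoc.prems(2) evals_not_applicable[of "apps t (ss @ [s])" m rs n] evals_deterministic
      by fastforce
  next
    case (App v' s')
    \<comment> \<open>For the shorter prefix the surplus \<open>s # rs\<close> is nonempty, which
      rules out the first alternative.\<close>
    then obtain u ss' where "v' = apps u ss'" "coval t u" "list_all2 coval ss ss'"
      using snoc.IH[of v' "s # rs"] snoc.prems(2) by auto
    then have "t' = apps u (ss' @ [s']) \<and> coval t u \<and> list_all2 coval (ss @ [s]) (ss' @ [s'])"
      using App by (simp add: list_all2_appendI)
    then show ?thesis by blast
  qed
qed

lemma coval_appsE:
  assumes "coval (apps t ss) t'" and "apps t ss \<Down> n"
  obtains "t' \<Down> n" | u ss' where "t' = apps u ss'" "coval t u" "list_all2 coval ss ss'"
  using coval_apps_cases[of t ss t' "[]" n] assms by auto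

lemma coval_LamD: "coval (Lam b) t \<Longrightarrow> \<exists>b'. t = Lam b' \<and> coval b b'"
  by (erule coval.cases) (auto simp: not_evals_Lam)

lemma coval_RecD: "coval Rec t \<Longrightarrow> t = Rec"
  by (erule coval.cases) (auto simp: not_evals_Rec)

lemma coval_UnivD: "coval Univ t \<Longrightarrow> t = Univ"
  by (erule coval.cases) (auto simp: not_evals_Univ)

text \<open>Induction on the evaluation. If \<open>base\<close> relates the whole terms, determinism
  finishes; otherwise \<open>t'\<close> has the same outer constructor or the same kind of head,
  performs the corresponding step, and its components or reducts are again related.\<close>

lemma coval_evals: "t \<Down> n \<Longrightarrow> coval t t' \<Longrightarrow> closed t' \<Longrightarrow> t' \<Down> n"
proof (induction arbitrary: t' rule: evals.induct)
  case zero
  from zero.prems(1) show ?case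
    by cases (auto intro: evals.zero dest: evals_ZeroD)
next
  case (succ t n)
  have val: "Succ t \<Down> n + 1" using succ.hyps by (rule evals.succ)
  from succ.prems(1) show ?case
    using val evals_deterministic succ.IH succ.prems(2)
    by cases (auto intro: evals.succ[simplified] simp: closed_def)
next
  case (eq_true t m u n)
  have val: "(t \<doteq> u) \<Down> 1" using eq_true.hyps by (rule evals.eq_true)
  from eq_true.prems(1) show ?case
  proof cases
    case (base k)
    then show ?thesis using val evals_deterministic by blast
  next
    case (Eq t2 u2)
    then show ?thesis using eq_true by (auto simp: closed_def intro!: evals.eq_true[simplified])
  qed
next
  case (eq_false t m u n)
  have val: "(t \<doteq> u) \<Down> 0" using eq_false.hyps by (rule evals.eq_false)
  from eq_false.prems(1) show ?case
  proof cases
    case (base k)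
    then show ?thesis using val evals_deterministic by blast
  next
    case (Eq t2 u2)
    then show ?thesis using eq_false
      by (auto simp: closed_def intro!: evals.eq_false[of _ m _ n])
  qed
next
  case (neg_true t)
  have val: "Neg t \<Down> 0" using neg_true.hyps by (rule evals.neg_true)
  from neg_true.prems(1) show ?case
    using val evals_deterministic neg_true.IH neg_true.prems(2)
    by cases (auto intro: evals.neg_true simp: closed_def)
next
  case (neg_false t)
  have val: "Neg t \<Down> 1" using neg_false.hyps by (rule evals.neg_false)
  from neg_false.prems(1) show ?case
    using val evals_deterministic neg_false.IH neg_false.prems(2)
    by cases (auto intro: evals.neg_false[simplified] simp: closed_def)
next
  case (or_true1 t u)
  have val: "(t \<squnion> u) \<Down> 1" using or_true1.hyps by (rule evals.or_true1)
  from or_true1.prems(1) show ?case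
    using val evals_deterministic or_true1.IH or_true1.prems(2)
    by cases (auto intro: evals.or_true1[simplified] simp: closed_def)
next
  case (or_true2 t u)
  have val: "(t \<squnion> u) \<Down> 1" using or_true2.hyps by (rule evals.or_true2)
  from or_true2.prems(1) show ?case
    using val evals_deterministic or_true2.IH or_true2.prems(2)
    by cases (auto intro: evals.or_true2[simplified] simp: closed_def)
next
  case (or_false t u)
  have val: "(t \<squnion> u) \<Down> 0" using or_false.hyps by (rule evals.or_false)
  from or_false.prems(1) show ?case
    using val evals_deterministic or_false.IH or_false.prems(2)
    by cases (auto intro: evals.or_false simp: closed_def)
next
  case (beta b t ss n)
  have "apps (Lam b \<cdot> t) ss \<Down> n" using beta.hyps by (rule evals.beta)
  \<comment> \<open>Moving \<open>t\<close> into the argument list leaves the bare abstraction as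
    head; having no value, it can only be related to another abstraction.\<close>
  then have val: "apps (Lam b) (t # ss) \<Down> n" by simp
  have co: "coval (apps (Lam b) (t # ss)) t'" using beta.prems(1) by simp
  show ?case
  proof (cases rule: coval_appsE[OF co val])
    case (2 u ss')
    then obtain b' s rs where t': "t' = apps (Lam b' \<cdot> s) rs"
      and co: "coval b b'" "coval t s" "list_all2 coval ss rs"
      by (auto simp: list_all2_Cons1 dest!: coval_LamD)
    have "closed (apps (beta_inst b' s) rs)"
      using beta.prems(2) closed_inst[of b' s] unfolding t' by (auto simp: closed_def fv_apps)
    then have "apps (beta_inst b' s) rs \<Down> n"
      using beta.IH coval_apps[OF co(3) coval_beta_inst[OF co(1,2)]] by blast
    then show ?thesis using beta.prems(2) evals.beta unfolding t' by blast
  qed simp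
next
  case (rec_zero g h a ss n)
  have "apps (Rec \<cdot> g \<cdot> h \<cdot> a) ss \<Down> n" using rec_zero.hyps by (rule evals.rec_zero)
  then have val: "apps Rec (g # h # a # ss) \<Down> n" by simp
  have co: "coval (apps Rec (g # h # a # ss)) t'" using rec_zero.prems(1) by simp
  show ?case
  proof (cases rule: coval_appsE[OF co val])
    case (2 u ss')
    then obtain g' h' a' rs where t': "t' = apps (Rec \<cdot> g' \<cdot> h' \<cdot> a') rs"
      and co: "coval g g'" "coval a a'" "list_all2 coval ss rs"
      by (auto simp: list_all2_Cons1 dest!: coval_RecD)
    have "closed a'" "closed (apps g' rs)"
      using rec_zero.prems(2) unfolding t' by (auto simp: closed_def fv_apps)
    then have "a' \<Down> 0" "apps g' rs \<Down> n"
      using rec_zero.IH co coval_apps[OF co(3,1)] by blast+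
    then show ?thesis using rec_zero.prems(2) evals.rec_zero unfolding t' by blast
  qed simp
next
  case (rec_succ a k h g ss n)
  have "apps (Rec \<cdot> g \<cdot> h \<cdot> a) ss \<Down> n" using rec_succ.hyps by (rule evals.rec_succ)
  then have val: "apps Rec (g # h # a # ss) \<Down> n" by simp
  have co: "coval (apps Rec (g # h # a # ss)) t'" using rec_succ.prems(1) by simp
  show ?case
  proof (cases rule: coval_appsE[OF co val])
    case (2 u ss')
    then obtain g' h' a' rs where t': "t' = apps (Rec \<cdot> g' \<cdot> h' \<cdot> a') rs"
      and co: "coval g g'" "coval h h'" "coval a a'" "list_all2 coval ss rs"
      by (auto simp: list_all2_Cons1 dest!: coval_RecD)
    \<comment> \<open>The reduct mentions the value of the recursion argument rather than the
      argument itself, so both sides carry the same numeral \<open>k\<close>.\<close>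
    let ?step = "\<lambda>g h. h \<cdot> numeral_trm k \<cdot> (Rec \<cdot> g \<cdot> h \<cdot> numeral_trm k)"
    have "closed a'" "closed (apps (?step g' h') rs)"
      using rec_succ.prems(2) closed_numeral[of k] unfolding t' by (auto simp: closed_def fv_apps)
    moreover have "coval (?step g h) (?step g' h')"
      using co by (intro coval.App coval_refl)
    ultimately have "a' \<Down> k + 1" "apps (?step g' h') rs \<Down> n"
      using rec_succ.IH co coval_apps[OF co(4)] by blast+
    then show ?thesis using evals.rec_succ unfolding t' by blast
  qed simp
next
  case (univ_true f)
  have val: "Univ \<cdot> f \<Down> 1" using univ_true.hyps by (rule evals.univ_true)
  from univ_true.prems(1) show ?case
  proof cases
    case (base m)
    then show ?thesis using val evals_deterministic by blast
  next
    case (App v f')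
    have "f' \<cdot> numeral_trm k \<Down> 1" for k
    proof (rule univ_true.IH)
      show "coval (f \<cdot> numeral_trm k) (f' \<cdot> numeral_trm k)"
        using App(3) coval_refl by (rule coval.App)
      show "closed (f' \<cdot> numeral_trm k)"
        using univ_true.prems(2) App(1) closed_numeral[of k] by (simp add: closed_def)
    qed
    then have "Univ \<cdot> f' \<Down> 1" by (rule evals.univ_true)
    then show ?thesis using App coval_UnivD by blast
  qed
next
  case (univ_false f k)
  have val: "Univ \<cdot> f \<Down> 0" using univ_false.hyps by (rule evals.univ_false)
  from univ_false.prems(1) show ?case
  proof cases
    case (base m)
    then show ?thesis using val evals_deterministic by blast
  next
    case (App v f')
    have "f' \<cdot> numeral_trm k \<Down> 0"
    proof (rule univ_false.IH)
      show "coval (f \<cdot> numeral_trm k) (f' \<cdot> numeral_trm k)"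
        using App(3) coval_refl by (rule coval.App)
      show "closed (f' \<cdot> numeral_trm k)"
        using univ_false.prems(2) App(1) closed_numeral[of k] by (simp add: closed_def)
    qed
    then have "Univ \<cdot> f' \<Down> 0" by (rule evals.univ_false)
    then show ?thesis using App coval_UnivD by blast
  qed
qed

text \<open>The two environments are related pointwise by \<open>coval\<close>. This serves the
  equality rule and the passage from numerals to arbitrary terms in induction.\<close>

lemma evals_psubst_replace:
  assumes "psubst (\<sigma>(i := a)) p \<Down> n" "a \<Down> m" "b \<Down> m" "\<And>i. closed (\<sigma> i)"
  shows "psubst (\<sigma>(i := b)) p \<Down> n"
proof (rule coval_evals[OF assms(1)])
  show "coval (psubst (\<sigma>(i := a)) p) (psubst (\<sigma>(i := b)) p)"
    using assms(2,3) by (intro coval_psubst coval_refl) (auto intro: coval.base coval_refl)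
  show "closed (psubst (\<sigma>(i := b)) p)"
    using assms(3,4) by (intro closed_psubst) (auto dest: evals_closed)
qed

lemma evals_App_replace:
  assumes "f \<cdot> a \<Down> n" "a \<Down> m" "b \<Down> m"
  shows "f \<cdot> b \<Down> n"
proof (rule coval_evals[OF assms(1)])
  show "coval (f \<cdot> a) (f \<cdot> b)" using assms(2,3) by (intro coval.App coval_refl coval.base)
  show "closed (f \<cdot> b)" using assms(1,3) by (auto simp: closed_def dest!: evals_closed)
qed

section \<open>Soundness\<close>

lemma evals_Zero_iff: "Zero \<Down> n \<longleftrightarrow> n = 0"
  using evals.zero evals_ZeroD by blast

lemma evals_Succ_iff: "Succ t \<Down> n \<longleftrightarrow> (\<exists>m. n = Suc m \<and> t \<Down> m)"
  using evals.succ[of t] evals_SuccD[of t n] by auto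

text \<open>Written with \<open>Suc 0\<close>, the form into which the simplifier brings
  \<open>1\<close>.\<close>

lemma evals_Eq_1_iff: "(t \<doteq> u) \<Down> Suc 0 \<longleftrightarrow> (\<exists>m. t \<Down> m \<and> u \<Down> m)"
  using evals.eq_true evals_EqD[of t u "Suc 0"] by (fastforce split: if_splits)

lemma evals_Eq_0_iff: "(t \<doteq> u) \<Down> 0 \<longleftrightarrow> (\<exists>m k. t \<Down> m \<and> u \<Down> k \<and> m \<noteq> k)"
  using evals.eq_false evals_EqD[of t u 0] by (fastforce split: if_splits)

lemma evals_Neg_iff: "Neg t \<Down> n \<longleftrightarrow> n = 0 \<and> t \<Down> 1 \<or> n = 1 \<and> t \<Down> 0"
  using evals.neg_true[of t] evals.neg_false[of t] evals_NegD[of t n] by auto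

text \<open>Closedness of both disjuncts stays explicit, since the truth of one disjunct gives no
  information about the other.\<close>

lemma evals_Or_iff:
  "(t \<squnion> u) \<Down> n \<longleftrightarrow> closed t \<and> closed u \<and> (n = 1 \<and> (t \<Down> 1 \<or> u \<Down> 1) \<or> n = 0 \<and> t \<Down> 0 \<and> u \<Down> 0)"
  using evals.or_true1[of t u] evals.or_true2[of t u] evals.or_false[of t u] evals_OrD[of t u n]
    evals_closed[of "t \<squnion> u" n]
  by (auto simp: closed_def)

lemma evals_Univ_iff:
  "Univ \<cdot> f \<Down> n \<longleftrightarrow> n = 1 \<and> (\<forall>k. f \<cdot> numeral_trm k \<Down> 1) \<or> n = 0 \<and> (\<exists>k. f \<cdot> numeral_trm k \<Down> 0)"
  using evals.univ_true[of f] evals.univ_false[of f] evals_UnivD[of f n] by auto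

lemmas evals_iffs = evals_Zero_iff evals_Succ_iff evals_Eq_1_iff evals_Eq_0_iff
  evals_Neg_iff evals_Or_iff evals_Univ_iff

text \<open>Variables range over all closed terms and not just numerals, because the substitution
  rule may insert a divergent term. Only an assumption \<open>isN (Var i)\<close> forces the
  variable to have a value.\<close>

definition closing :: "(nat \<Rightarrow> trm) \<Rightarrow> bool" where
  "closing \<sigma> \<longleftrightarrow> (\<forall>i. closed (\<sigma> i))"

definition satisfies :: "(nat \<Rightarrow> trm) \<Rightarrow> trm \<Rightarrow> bool"  (infix "\<Turnstile>" 50) where
  "\<sigma> \<Turnstile> c \<longleftrightarrow> psubst \<sigma> c \<Down> 1"

definition valid :: "sequent \<Rightarrow> bool" where
  "valid J \<longleftrightarrow> (\<forall>\<sigma>. closing \<sigma> \<longrightarrow> (\<forall>d\<in>fst J. \<sigma> \<Turnstile> d) \<longrightarrow> \<sigma> \<Turnstile> snd J)"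

lemma validI: "(\<And>\<sigma>. closing \<sigma> \<Longrightarrow> \<forall>d\<in>\<Gamma>. \<sigma> \<Turnstile> d \<Longrightarrow> \<sigma> \<Turnstile> c) \<Longrightarrow> valid (\<Gamma> \<turnstile> c)"
  by (simp add: valid_def)

lemma validD: "valid (\<Gamma> \<turnstile> c) \<Longrightarrow> closing \<sigma> \<Longrightarrow> \<forall>d\<in>\<Gamma>. \<sigma> \<Turnstile> d \<Longrightarrow> \<sigma> \<Turnstile> c"
  by (simp add: valid_def)

text \<open>For rules that keep the context, soundness reduces to an implication under one fixed
  environment.\<close>

lemma valid_mp: "valid (\<Gamma> \<turnstile> a) \<Longrightarrow> (\<And>\<sigma>. closing \<sigma> \<Longrightarrow> \<sigma> \<Turnstile> a \<Longrightarrow> \<sigma> \<Turnstile> c) \<Longrightarrow> valid (\<Gamma> \<turnstile> c)"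
  by (simp add: valid_def)

lemma valid_mp2:
  "valid (\<Gamma> \<turnstile> a) \<Longrightarrow> valid (\<Gamma> \<turnstile> b) \<Longrightarrow> (\<And>\<sigma>. closing \<sigma> \<Longrightarrow> \<sigma> \<Turnstile> a \<Longrightarrow> \<sigma> \<Turnstile> b \<Longrightarrow> \<sigma> \<Turnstile> c)
    \<Longrightarrow> valid (\<Gamma> \<turnstile> c)"
  by (simp add: valid_def)

lemma closing_closed: "closing \<sigma> \<Longrightarrow> closed (psubst \<sigma> t)"
  by (simp add: closing_def closed_psubst)

lemma closed_Eq: "closed (t \<doteq> u) \<longleftrightarrow> closed t \<and> closed u"
  by (simp add: closed_def)

lemma closed_Neg: "closed (Neg t) \<longleftrightarrow> closed t"
  by (simp add: closed_def)

lemma closing_upd: "closing \<sigma> \<Longrightarrow> closed a \<Longrightarrow> closing (\<sigma>(i := a))"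
  by (simp add: closing_def)

text \<open>The environment for the quantifier rules: the fresh variable 0 denotes a numeral, while
  shifted terms keep their interpretation by \<open>psubst_push_up\<close>.\<close>

lemma closing_push: "closing \<sigma> \<Longrightarrow> closing (case_nat (numeral_trm k) \<sigma>)"
  by (auto simp: closing_def closed_numeral split: nat.split)

lemma satisfies_subst: "\<sigma> \<Turnstile> subst i s c \<longleftrightarrow> \<sigma>(i := psubst \<sigma> s) \<Turnstile> c"
  by (simp add: satisfies_def psubst_subst)

lemma psubst_push_up: "psubst (case_nat a \<sigma>) (up t) = psubst \<sigma> t"
  by (simp add: psubst_up)

lemma satisfies_isN: "\<sigma> \<Turnstile> isN a \<longleftrightarrow> (\<exists>m. psubst \<sigma> a \<Down> m)"
  by (auto simp: satisfies_def evals_iffs dest: evals_deterministic)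

lemma satisfies_head_step: "c \<rhd> c' \<Longrightarrow> closing \<sigma> \<Longrightarrow> psubst \<sigma> c \<Down> n \<longleftrightarrow> psubst \<sigma> c' \<Down> n"
  by (rule evals_head_step[OF head_step_psubst closing_closed])

text \<open>Ordinary induction on \<open>k\<close> settles all numerals; \<open>a\<close> is then
  exchanged for the numeral of its value.\<close>

lemma valid_induction:
  assumes i: "i \<notin> (\<Union>d\<in>\<Gamma>. fv d)"
    and zero: "valid (\<Gamma> \<turnstile> subst i Zero c)"
    and step: "valid (insert (isN (Var i)) (insert c \<Gamma>) \<turnstile> subst i (Succ (Var i)) c)"
    and a: "valid (\<Gamma> \<turnstile> isN a)"
  shows "valid (\<Gamma> \<turnstile> subst i a c)"
proof (rule validI)
  fix \<sigma> assume \<sigma>: "closing \<sigma>" "\<forall>d\<in>\<Gamma>. \<sigma> \<Turnstile> d"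
  have num: "\<sigma>(i := numeral_trm k) \<Turnstile> c" for k
  proof (induction k)
    case 0
    then show ?case using validD[OF zero \<sigma>] by (auto simp: satisfies_subst simp del: fun_upd_apply)
  next
    case (Suc k)
    let ?\<tau> = "\<sigma>(i := numeral_trm k)"
    \<comment> \<open>The freshness of \<open>i\<close> keeps the context true while the value of
      the induction variable changes.\<close>
    have "psubst ?\<tau> d = psubst \<sigma> d" if "d \<in> \<Gamma>" for d
      using that i by (intro psubst_cong) auto
    then have "\<forall>d\<in>\<Gamma>. ?\<tau> \<Turnstile> d" using \<sigma>(2) by (simp add: satisfies_def)
    moreover have "?\<tau> \<Turnstile> isN (Var i)" using evals_numeral by (auto simp: satisfies_isN)
    moreover have "closing ?\<tau>" using \<sigma>(1) closed_numeral by (rule closing_upd)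
    ultimately have "?\<tau> \<Turnstile> subst i (Succ (Var i)) c"
      using Suc by (intro validD[OF step]) (simp_all del: fun_upd_apply)
    then show ?case by (simp add: satisfies_subst fun_upd_same del: fun_upd_apply)
  qed
  obtain m where "psubst \<sigma> a \<Down> m" using validD[OF a \<sigma>] by (auto simp: satisfies_isN)
  then show "\<sigma> \<Turnstile> subst i a c"
    using evals_psubst_replace[OF _ evals_numeral[of m], of \<sigma> i c 1] num[of m] \<sigma>(1)
    by (simp add: satisfies_def psubst_subst closing_def)
qed

text \<open>Evaluation unfolds the recursor at the numeral of the value of \<open>m\<close>, whereas
  the rule keeps \<open>m\<close> itself; interchangeability bridges the two.\<close>

lemma valid_rec_unfold:
  assumes m: "valid (\<Gamma> \<turnstile> isN m)" and v: "valid (\<Gamma> \<turnstile> isN (h \<cdot> m \<cdot> (Rec \<cdot> g \<cdot> h \<cdot> m)))"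
  shows "valid (\<Gamma> \<turnstile> Rec \<cdot> g \<cdot> h \<cdot> Succ m \<doteq> h \<cdot> m \<cdot> (Rec \<cdot> g \<cdot> h \<cdot> m))"
proof (rule validI)
  fix \<sigma> assume \<sigma>: "closing \<sigma>" "\<forall>d\<in>\<Gamma>. \<sigma> \<Turnstile> d"
  define m' where "m' = psubst \<sigma> m"
  define h' where "h' = psubst \<sigma> h"
  define g' where "g' = psubst \<sigma> g"
  obtain k where k: "m' \<Down> k" using validD[OF m \<sigma>] by (auto simp: satisfies_isN m'_def)
  obtain n where n: "h' \<cdot> m' \<cdot> (Rec \<cdot> g' \<cdot> h' \<cdot> m') \<Down> n"
    using validD[OF v \<sigma>] unfolding satisfies_isN by (auto simp: m'_def h'_def g'_def)
  have "h' \<cdot> numeral_trm k \<cdot> (Rec \<cdot> g' \<cdot> h' \<cdot> numeral_trm k) \<Down> n"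
  proof (rule coval_evals[OF n])
    have "coval m' (numeral_trm k)" using k evals_numeral by (rule coval.base)
    then show "coval (h' \<cdot> m' \<cdot> (Rec \<cdot> g' \<cdot> h' \<cdot> m'))
        (h' \<cdot> numeral_trm k \<cdot> (Rec \<cdot> g' \<cdot> h' \<cdot> numeral_trm k))"
      by (intro coval.App coval_refl)
    show "closed (h' \<cdot> numeral_trm k \<cdot> (Rec \<cdot> g' \<cdot> h' \<cdot> numeral_trm k))"
      using evals_closed[OF n] closed_numeral[of k] by (auto simp: closed_def)
  qed
  moreover have "Succ m' \<Down> k + 1" using k by (rule evals.succ)
  ultimately have "Rec \<cdot> g' \<cdot> h' \<cdot> Succ m' \<Down> n"
    using evals.rec_succ[of "Succ m'" k h' g' "[]" n] by simp
  then show "\<sigma> \<Turnstile> Rec \<cdot> g \<cdot> h \<cdot> Succ m \<doteq> h \<cdot> m \<cdot> (Rec \<cdot> g \<cdot> h \<cdot> m)"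
    using n evals.eq_true by (simp add: satisfies_def m'_def h'_def g'_def)
qed

text \<open>The cases written out change the context or environment, exchange terms of equal value,
  or need a particular value as witness.\<close>

lemma rga_rule_sound: "rga_rule Js J \<Longrightarrow> \<forall>K \<in> set Js. valid K \<Longrightarrow> valid J"
proof (induction rule: rga_rule.induct)
  case (or_elim \<Gamma> a b c)
  show ?case
  proof (rule validI)
    fix \<sigma> assume \<sigma>: "closing \<sigma>" "\<forall>d\<in>\<Gamma>. \<sigma> \<Turnstile> d"
    have "valid (\<Gamma> \<turnstile> a \<squnion> b)" "valid (insert a \<Gamma> \<turnstile> c)" "valid (insert b \<Gamma> \<turnstile> c)"
      using or_elim by simp_all
    note prem = this[THEN validD[OF _ \<sigma>(1)]]
    have "\<sigma> \<Turnstile> a \<or> \<sigma> \<Turnstile> b"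
      using prem(1) \<sigma>(2) by (auto simp: satisfies_def evals_Or_iff)
    then show "\<sigma> \<Turnstile> c" using prem(2,3) \<sigma>(2) by blast
  qed
next
  case (substitution \<Gamma> c i s)
  show ?case
  proof (rule validI)
    fix \<sigma> assume \<sigma>: "closing \<sigma>" "\<forall>d\<in>subst i s ` \<Gamma>. \<sigma> \<Turnstile> d"
    have "valid (\<Gamma> \<turnstile> c)" using substitution by simp
    moreover have "closing (\<sigma>(i := psubst \<sigma> s))"
      using \<sigma>(1) closing_closed[OF \<sigma>(1)] by (rule closing_upd)
    moreover have "\<forall>d\<in>\<Gamma>. \<sigma>(i := psubst \<sigma> s) \<Turnstile> d" using \<sigma>(2) by (simp add: satisfies_subst)
    ultimately show "\<sigma> \<Turnstile> subst i s c" unfolding satisfies_subst by (rule validD)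
  qed
next
  case (eq_subst \<Gamma> a b i p)
  show ?case
  proof (rule validI)
    fix \<sigma> assume \<sigma>: "closing \<sigma>" "\<forall>d\<in>\<Gamma>. \<sigma> \<Turnstile> d"
    have "valid (\<Gamma> \<turnstile> a \<doteq> b)" "valid (\<Gamma> \<turnstile> subst i a p)" using eq_subst by simp_all
    then have "\<sigma> \<Turnstile> a \<doteq> b" "\<sigma> \<Turnstile> subst i a p" using \<sigma> by (simp_all add: validD)
    then obtain m where "psubst \<sigma> (subst i a p) \<Down> 1" "psubst \<sigma> a \<Down> m" "psubst \<sigma> b \<Down> m"
      by (auto simp: satisfies_def evals_iffs)
    then show "\<sigma> \<Turnstile> subst i b p"
      using evals_psubst_replace[of \<sigma> i "psubst \<sigma> a" p 1 m "psubst \<sigma> b"] \<sigma>(1)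
      by (simp add: satisfies_def psubst_subst closing_def)
  qed
next
  case (induction i \<Gamma> c a)
  then show ?case by (simp add: valid_induction)
next
  case (conv_eq c c' \<Gamma>)
  show ?case
  proof (rule validI)
    fix \<sigma> assume \<sigma>: "closing \<sigma>" "\<forall>d\<in>\<Gamma>. \<sigma> \<Turnstile> d"
    have "valid (\<Gamma> \<turnstile> isN c')" using conv_eq by simp
    then obtain m where "psubst \<sigma> c' \<Down> m" using validD \<sigma> by (meson satisfies_isN)
    then show "\<sigma> \<Turnstile> c \<doteq> c'"
      using conv_eq.hyps \<sigma>(1) by (auto simp: satisfies_def evals_Eq_1_iff satisfies_head_step)
  qed
next
  case (rec_unfold \<Gamma> m h g)
  then show ?case by (simp add: valid_rec_unfold)
next
  case (univ_intro \<Gamma> f)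
  show ?case
  proof (rule validI)
    fix \<sigma> assume \<sigma>: "closing \<sigma>" "\<forall>d\<in>\<Gamma>. \<sigma> \<Turnstile> d"
    have "psubst \<sigma> f \<cdot> numeral_trm k \<Down> 1" for k
    proof -
      let ?\<tau> = "case_nat (numeral_trm k) \<sigma>"
      have "?\<tau> \<Turnstile> isN (Var 0)" using evals_numeral by (auto simp: satisfies_isN)
      moreover have "\<forall>d\<in>up ` \<Gamma>. ?\<tau> \<Turnstile> d" using \<sigma>(2) by (simp add: satisfies_def psubst_push_up)
      moreover have "valid (insert (isN (Var 0)) (up ` \<Gamma>) \<turnstile> up f \<cdot> Var 0)"
        using univ_intro by simp
      ultimately have "?\<tau> \<Turnstile> up f \<cdot> Var 0"
        using closing_push[OF \<sigma>(1)] by (simp add: validD)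
      then show ?thesis by (simp add: satisfies_def psubst_push_up)
    qed
    then show "\<sigma> \<Turnstile> Univ \<cdot> f" by (simp add: satisfies_def evals_Univ_iff)
  qed
next
  case (univ_elim \<Gamma> f a)
  show ?case
  proof (rule validI)
    fix \<sigma> assume \<sigma>: "closing \<sigma>" "\<forall>d\<in>\<Gamma>. \<sigma> \<Turnstile> d"
    have "valid (\<Gamma> \<turnstile> Univ \<cdot> f)" "valid (\<Gamma> \<turnstile> isN a)" using univ_elim by simp_all
    then have "\<sigma> \<Turnstile> Univ \<cdot> f" "\<sigma> \<Turnstile> isN a" using \<sigma> by (simp_all add: validD)
    \<comment> \<open>The quantifier provides the instance at the numeral of the value of
      \<open>a\<close>, which is then replaced by \<open>a\<close>.\<close>
    then show "\<sigma> \<Turnstile> f \<cdot> a"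
      unfolding satisfies_isN using evals_numeral
      by (auto simp: satisfies_def evals_Univ_iff intro: evals_App_replace)
  qed
next
  case (neg_univ_intro \<Gamma> f a)
  show ?case
  proof (rule validI)
    fix \<sigma> assume \<sigma>: "closing \<sigma>" "\<forall>d\<in>\<Gamma>. \<sigma> \<Turnstile> d"
    have "valid (\<Gamma> \<turnstile> Neg (f \<cdot> a))" "valid (\<Gamma> \<turnstile> isN a)" using neg_univ_intro by simp_all
    then have "\<sigma> \<Turnstile> Neg (f \<cdot> a)" "\<sigma> \<Turnstile> isN a" using \<sigma> by (simp_all add: validD)
    then show "\<sigma> \<Turnstile> Neg (Univ \<cdot> f)"
      unfolding satisfies_isN using evals_numeral
      by (auto simp: satisfies_def evals_Univ_iff evals_Neg_iff intro: evals_App_replace)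
  qed
next
  case (neg_univ_elim \<Gamma> f c)
  show ?case
  proof (rule validI)
    fix \<sigma> assume \<sigma>: "closing \<sigma>" "\<forall>d\<in>\<Gamma>. \<sigma> \<Turnstile> d"
    have prem: "valid (\<Gamma> \<turnstile> Neg (Univ \<cdot> f))"
      "valid (insert (isN (Var 0)) (insert (Neg (up f \<cdot> Var 0)) (up ` \<Gamma>)) \<turnstile> up c)"
      using neg_univ_elim by simp_all
    have "\<sigma> \<Turnstile> Neg (Univ \<cdot> f)" using prem(1) \<sigma> by (rule validD)
    \<comment> \<open>A false quantifier evaluates through a numeral counterexample, which
      interprets the fresh variable of the second premise.\<close>
    then obtain k where k: "psubst \<sigma> f \<cdot> numeral_trm k \<Down> 0"
      by (auto simp: satisfies_def evals_Univ_iff evals_Neg_iff)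
    let ?\<tau> = "case_nat (numeral_trm k) \<sigma>"
    have "?\<tau> \<Turnstile> isN (Var 0)" using evals_numeral by (auto simp: satisfies_isN)
    moreover have "?\<tau> \<Turnstile> Neg (up f \<cdot> Var 0)"
      using k by (simp add: satisfies_def evals_Neg_iff psubst_push_up)
    moreover have "\<forall>d\<in>up ` \<Gamma>. ?\<tau> \<Turnstile> d" using \<sigma>(2) by (simp add: satisfies_def psubst_push_up)
    ultimately have "?\<tau> \<Turnstile> up c"
      using closing_push[OF \<sigma>(1)] by (intro validD[OF prem(2)]) simp_all
    then show "\<sigma> \<Turnstile> c" by (simp add: satisfies_def psubst_push_up)
  qed
\<comment> \<open>Rules over a fixed context reduce through \<open>valid_mp\<close> and
  \<open>valid_mp2\<close> to the evaluation equivalences; those of another shape, such as weakening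
  and cut, follow by unfolding validity.\<close>
qed ((simp, (erule valid_mp | (elim conjE, erule (1) valid_mp2)),
      fastforce simp: satisfies_def evals_iffs satisfies_head_step closing_closed closed_Eq closed_Neg
        not_evals_Bot dest: evals_deterministic)
    | (auto simp: valid_def satisfies_def evals_iffs)[1])+

lemma oga_rule_sound: "oga_rule Js J \<Longrightarrow> \<forall>K \<in> set Js. valid K \<Longrightarrow> valid J"
proof (induction rule: oga_rule.induct)
  case (rga Js J)
  then show ?case by (rule rga_rule_sound)
next
  case (ati \<Gamma> u)
  show ?case
  proof (rule validI)
    fix \<sigma> assume \<sigma>: "closing \<sigma>" "\<forall>d\<in>\<Gamma>. \<sigma> \<Turnstile> d"
    let ?u = "psubst \<sigma> u"
    have "valid (\<Gamma> \<turnstile> Univ \<cdot> Lam (isB (up u \<cdot> Var 0)))" using ati by simp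
    then have "\<sigma> \<Turnstile> Univ \<cdot> Lam (isB (up u \<cdot> Var 0))" using \<sigma> by (rule validD)
    then have "Lam (isB (up ?u \<cdot> Var 0)) \<cdot> numeral_trm k \<Down> 1" for k
      by (simp add: satisfies_def evals_Univ_iff psubst_up lift_psubst)
    then have "isB (?u \<cdot> numeral_trm k) \<Down> 1" for k
      using evals_betaD[of _ "numeral_trm k" "[]" 1] by (fastforce simp: beta_inst_up)
    then have "?u \<cdot> numeral_trm k \<Down> 1 \<or> ?u \<cdot> numeral_trm k \<Down> 0" for k
      by (auto simp: evals_Or_iff evals_Neg_iff)
    \<comment> \<open>Classically, either every numeral instance has value 1 or some instance has
      value 0; each alternative decides the quantifier.\<close>
    then show "\<sigma> \<Turnstile> isB (Univ \<cdot> u)"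
      using closing_closed[OF \<sigma>(1), of u]
      by (auto simp: satisfies_def evals_Or_iff evals_Neg_iff evals_Univ_iff closed_def)
  qed
qed

text \<open>Strong induction on the position in the proof, as premises are arbitrary earlier
  entries.\<close>

lemma oga_derivable_sound: "oga_derivable J \<Longrightarrow> valid J"
proof -
  assume "oga_derivable J"
  then obtain P where P: "is_proof oga_rule P" and "J \<in> set P" by (auto simp: derivable_def)
  have "valid (P ! i)" if "i < length P" for i
    using that
  proof (induction i rule: less_induct)
    case (less i)
    then obtain Js where "set Js \<subseteq> set (take i P)" "oga_rule Js (P ! i)"
      using P by (auto simp: is_proof_def)
    moreover have "valid K" if "K \<in> set (take i P)" for K
      using that less by (auto simp: in_set_conv_nth)
    ultimately show ?case using oga_rule_sound by blast
  qed
  then show "valid J" using \<open>J \<in> set P\<close> by (auto simp: in_set_conv_nth)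
qed

theorem theorem6p9:
  fixes E1 E2 :: "trm set"
  assumes "finite E1" and "finite E2"
    and "\<forall>e\<in>E1. closed e" and "\<forall>e\<in>E2. closed e"
    and "\<forall>e\<in>E1. certified_adoptable e" and "\<forall>e\<in>E2. certified_adoptable e"
  shows "\<not> (\<exists>c. oga_derivable (E1 \<union> E2 \<turnstile> c) \<and> oga_derivable (E1 \<union> E2 \<turnstile> Neg c))"
proof
  assume "\<exists>c. oga_derivable (E1 \<union> E2 \<turnstile> c) \<and> oga_derivable (E1 \<union> E2 \<turnstile> Neg c)"
  then obtain c where c: "valid (E1 \<union> E2 \<turnstile> c)" "valid (E1 \<union> E2 \<turnstile> Neg c)"
    using oga_derivable_sound by blast
  \<comment> \<open>Any closed terms would do as values: the members of the stock are closed, so the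
    environment affects at most \<open>c\<close>.\<close>
  let ?\<sigma> = "\<lambda>_. Zero"
  have "closing ?\<sigma>" by (simp add: closing_def closed_def)
  moreover have "\<forall>d\<in>E1 \<union> E2. ?\<sigma> \<Turnstile> d"
    using assms(5,6)
    by (auto simp: satisfies_def certified_adoptable_def omega_true_def psubst_closed)
  ultimately have "?\<sigma> \<Turnstile> c" "?\<sigma> \<Turnstile> Neg c" using c by (simp_all add: validD)
  then show False by (auto simp: satisfies_def evals_Neg_iff dest: evals_deterministic)
qed

end
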